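(* The first moment of the one-parameter family $E: y^2=4x^3+(4m+1)x^2+n\cdot t x$ (with parameter $t$ and integers $m,n$) is $0$, that is, $A_{1,E}(p)=0$.
   Context: Here $p$ is an odd prime and $\left(\frac{\cdot}{p}\right)$ denotes the Legendre symbol, with $\left(\frac{u}{p}\right)=0$ if $p\mid u$. For a family $y^2=f_t(x)$, with $f_t(x)$ a cubic polynomial in $x$ whose coefficients are integer polynomials in $t$, one sets $a_t(p):=p-\#\{(x,y)\in(\mathbb{Z}/p\mathbb{Z})^2: y^2\equiv f_t(x) \bmod p\}=-\sum_{x \bmod p}\left(\frac{f_t(x)}{p}\right)$. The first moment of the family is $A_{1,E}(p):=\frac1p\sum_{t \bmod p}a_t(p)$, the sum running over all residues $t$ modulo $p$.
   Formalization: The formal statement assumes that p does not divide n, or that p divides 4m+1; in the remaining case (p divides n but not 4m+1) the claim fails, since the first moment is then the Legendre symbol ((4m+1)/p), e.g. 1 for p=3, m=n=0. *)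

theory Defs
  imports "HOL-Number_Theory.Number_Theory" "HOL-Computational_Algebra.Polynomial"
begin

text \<open>
  A family \<open>y\<^sup>2 = f\<^sub>t(x)\<close> is given by \<open>f :: int poly poly\<close>: the outer polynomial is in \<open>x\<close>,
  its coefficients are integer polynomials in the parameter \<open>t\<close>.
\<close>

definition fibre :: "int poly poly \<Rightarrow> int \<Rightarrow> int poly" where
  "fibre f t = map_poly (\<lambda>c. poly c t) f"

text \<open>Residue classes modulo \<open>p\<close> are represented by \<open>{0..<p}\<close>; only affine points are counted.\<close>

definition affine_points :: "int poly \<Rightarrow> nat \<Rightarrow> (int \<times> int) set" where
  "affine_points g p =
     {(x, y). x \<in> {0..<int p} \<and> y \<in> {0..<int p} \<and> [y\<^sup>2 = poly g x] (mod int p)}"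

definition trace_at :: "int poly poly \<Rightarrow> nat \<Rightarrow> int \<Rightarrow> int" where
  "trace_at f p t = int p - int (card (affine_points (fibre f t) p))"

definition first_moment :: "int poly poly \<Rightarrow> nat \<Rightarrow> real" where
  "first_moment f p = 1 / real p * (\<Sum>t\<in>{0..<int p}. of_int (trace_at f p t))"

text \<open>\<open>4x\<^sup>3 + (4m+1)x\<^sup>2 + n t x\<close>, coefficients listed from the constant term upwards.\<close>

definition family_E :: "int \<Rightarrow> int \<Rightarrow> int poly poly" where
  "family_E m n = [:0, [:0, n:], [:4 * m + 1:], [:4:]:]"

lemma poly_fibre_family_E:
  "poly (fibre (family_E m n) t) x = 4 * x ^ 3 + (4 * m + 1) * x\<^sup>2 + n * t * x"
  by (simp add: fibre_def family_E_def map_poly_pCons algebra_simps power2_eq_square power3_eq_cube)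

end

(* The trace sum vanishes once the triples (t, x, y) on the family number p^2.
   If p does not divide n, the equation is linear in t over every x \<noteq> 0, so each y occurs for
   exactly one t there, while over x = 0 only y = 0 occurs, for every t.
   If p divides both n and 4m+1, every fibre is the cuspidal cubic y^2 = 4x^3, which
   z \<mapsto> (z^2, 2z^3) parametrizes bijectively. *)
theory Submission
  imports Defs
begin

text \<open>Used twice: to solve for the parameter t over x \<noteq> 0, and for the parameter z =
  y/(2x) of the cuspidal cubic.\<close>

lemma linear_cong_solvable:
  fixes p a b :: int
  assumes "prime p" and "\<not> p dvd a"
  obtains t where "t \<in> {0..<p}" and "[a * t = b] (mod p)"
proof -
  have "coprime a p"
    using prime_imp_coprime[OF assms] by (rule coprime_commute[THEN iffD1])
  then obtain c where c: "[a * c = 1] (mod p)"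
    using cong_solve_coprime_int by blast
  have "[a * (c * b mod p) = (a * c) * b] (mod p)"
    by (simp add: cong_def mod_mult_right_eq mult.assoc)
  also have "[(a * c) * b = 1 * b] (mod p)"
    using c by (rule cong_mult) simp
  finally show thesis
    using that[of "c * b mod p"] prime_gt_0_int[OF assms(1)] by simp
qed

lemma cong_residues_eq:
  fixes p a b :: int
  assumes "[a = b] (mod p)" and "a \<in> {0..<p}" and "b \<in> {0..<p}"
  shows "a = b"
  using assms by (simp add: cong_def)

lemma affine_points_subset: "affine_points g p \<subseteq> {0..<int p} \<times> {0..<int p}"
  by (auto simp: affine_points_def)

lemma finite_affine_points: "finite (affine_points g p)"
  by (rule finite_subset[OF affine_points_subset]) simp

text \<open>Turns a real average into an equation between natural numbers, which a bijection can
  prove.\<close>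

lemma first_moment_eq_0_iff:
  assumes "p > 0"
  shows "first_moment f p = 0 \<longleftrightarrow>
    (\<Sum>t\<in>{0..<int p}. card (affine_points (fibre f t) p)) = p\<^sup>2"
proof -
  have "first_moment f p = 0 \<longleftrightarrow> (\<Sum>t\<in>{0..<int p}. trace_at f p t) = 0"
    using assms by (simp add: first_moment_def flip: of_int_sum)
  also have "(\<Sum>t\<in>{0..<int p}. trace_at f p t) =
      int (p\<^sup>2) - int (\<Sum>t\<in>{0..<int p}. card (affine_points (fibre f t) p))"
    by (simp add: trace_at_def sum_subtractf power2_eq_square)
  finally show ?thesis
    by linarith
qed

lemma sum_card_affine_points_family_E:
  assumes "prime p" and "\<not> int p dvd n"
  shows "(\<Sum>t\<in>{0..<int p}. card (affine_points (fibre (family_E m n) t) p)) = p\<^sup>2"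
proof -
  define P where "P = int p"
  have P: "prime P" "P > 0"
    using assms(1) prime_gt_0_nat by (auto simp: P_def)
  define c where "c x = 4 * x ^ 3 + (4 * m + 1) * x\<^sup>2" for x :: int
  define S where "S = (SIGMA t:{0..<P}. affine_points (fibre (family_E m n) t) p)"
  have S: "(t, x, y) \<in> S \<longleftrightarrow> t \<in> {0..<P} \<and> x \<in> {0..<P} \<and> y \<in> {0..<P} \<and>
      [y\<^sup>2 = c x + (n * x) * t] (mod P)" for t x y
    by (auto simp: S_def affine_points_def poly_fibre_family_E P_def c_def mult_ac)
  \<comment> \<open>The coefficient of t in the equation is n * x. It is invertible because 0 < x <
    P.\<close>
  have unit: "\<not> P dvd n * x" if "x \<in> {0..<P}" "x \<noteq> 0" for x
    using that assms(2) P zdvd_not_zless[of x P] by (auto simp: prime_dvd_mult_iff P_def)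
  have over_0: "y = 0" if "(t, 0, y) \<in> S" for t y
  proof -
    have "P dvd y\<^sup>2"
      using that by (simp add: S c_def cong_0_iff)
    then have "[y = 0] (mod P)"
      using P prime_dvd_power by (auto simp: cong_0_iff)
    then show ?thesis
      using that P by (intro cong_residues_eq[of y 0 P]) (auto simp: S)
  qed
  \<comment> \<open>The second coordinate records whichever variable is still free: t over x = 0,
    where y is forced to be 0, and y elsewhere, where t is forced. The two pieces together fill the
    square.\<close>
  have "bij_betw (\<lambda>(t, x, y). (x, if x = 0 then t else y)) S ({0..<P} \<times> {0..<P})"
    unfolding bij_betw_def
  proof
    show "inj_on (\<lambda>(t, x, y). (x, if x = 0 then t else y)) S"
    proof (rule inj_onI)
      fix u v assume uv: "u \<in> S" "v \<in> S"
        "(case u of (t, x, y) \<Rightarrow> (x, if x = 0 then t else y)) =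
          (case v of (t, x, y) \<Rightarrow> (x, if x = 0 then t else y))"
      obtain t x y where u: "u = (t, x, y)" by (rule prod_cases3)
      obtain t' x' y' where v: "v = (t', x', y')" by (rule prod_cases3)
      have *: "(t, x, y) \<in> S" "(t', x', y') \<in> S"
        and eq: "x = x'" "(if x = 0 then t else y) = (if x' = 0 then t' else y')"
        using uv unfolding u v prod.case prod.inject by blast+
      show "u = v"
      proof (cases "x = 0")
        case True
        then have "y = 0" "y' = 0"
          using * eq(1) over_0[of t y] over_0[of t' y'] by simp_all
        then show ?thesis using True eq u v by simp
      next
        case False
        then have e: "x' = x" "y' = y" using eq by simp_all
        have "[y\<^sup>2 = c x + (n * x) * t] (mod P)" "[y\<^sup>2 = c x + (n * x) * t'] (mod P)"
          using * unfolding S e by blast+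
        then have "[c x + (n * x) * t = c x + (n * x) * t'] (mod P)"
          by (rule cong_trans[OF cong_sym])
        then have "[(n * x) * t = (n * x) * t'] (mod P)"
          by (rule cong_add_lcancel[THEN iffD1])
        moreover have "coprime (n * x) P"
          using prime_imp_coprime[OF P(1) unit[of x]] False *(1)
          unfolding S by (subst coprime_commute) blast
        ultimately have "[t = t'] (mod P)"
          by (simp add: cong_mult_lcancel)
        then have "t = t'"
          by (rule cong_residues_eq) (use * in \<open>auto simp: S\<close>)
        then show ?thesis using e u v by simp
      qed
    qed
    show "(\<lambda>(t, x, y). (x, if x = 0 then t else y)) ` S = {0..<P} \<times> {0..<P}"
    proof (intro equalityI subsetI)
      fix z assume "z \<in> (\<lambda>(t, x, y). (x, if x = 0 then t else y)) ` S"
      then show "z \<in> {0..<P} \<times> {0..<P}" by (auto simp: S)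
    next
      fix z assume "z \<in> {0..<P} \<times> {0..<P}"
      then obtain x s where z: "z = (x, s)" "x \<in> {0..<P}" "s \<in> {0..<P}" by blast
      show "z \<in> (\<lambda>(t, x, y). (x, if x = 0 then t else y)) ` S"
      proof (cases "x = 0")
        case True
        \<comment> \<open>At x = 0 both \<open>c x\<close> and the term in t vanish, so y = 0 solves
          the equation for every parameter s.\<close>
        then have "(s, 0, 0) \<in> S" using z P by (simp add: S c_def)
        then show ?thesis by (rule rev_image_eqI) (simp add: True z)
      next
        case False
        obtain t where t: "t \<in> {0..<P}" "[(n * x) * t = s\<^sup>2 - c x] (mod P)"
          using linear_cong_solvable[OF P(1) unit[OF z(2) False]] by blast
        have "[c x + (n * x) * t = c x + (s\<^sup>2 - c x)] (mod P)"
          using t(2) by (intro cong_add) auto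
        then have "(t, x, s) \<in> S"
          using t(1) z by (simp add: S cong_sym)
        then show ?thesis by (rule rev_image_eqI) (simp add: False z)
      qed
    qed
  qed
  then have "card S = p\<^sup>2"
    by (simp add: bij_betw_same_card card_cartesian_product P_def power2_eq_square)
  then show ?thesis
    by (simp add: S_def P_def finite_affine_points)
qed

text \<open>Away from the cusp the parametrization is inverted by z = y/(2x), where oddness of p
  makes 2 invertible. Only the values of g modulo p are constrained, since its lower coefficients
  need only be divisible by p.\<close>

lemma card_affine_points_cuspidal:
  assumes "prime p" and "odd p" and g: "\<And>x. [poly g x = 4 * x ^ 3] (mod int p)"
  shows "card (affine_points g p) = p"
proof -
  define P where "P = int p"
  have P: "prime P" "P > 0"
    using assms(1) prime_gt_0_nat by (auto simp: P_def)
  have two: "\<not> P dvd 2"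
    using assms primes_dvd_imp_eq[of P 2] P by (auto simp: P_def)
  have mem: "(x, y) \<in> affine_points g p \<longleftrightarrow>
      x \<in> {0..<P} \<and> y \<in> {0..<P} \<and> [y\<^sup>2 = 4 * x ^ 3] (mod P)" for x y
    using g cong_trans[OF _ g] cong_trans[OF _ cong_sym[OF g]]
    by (auto simp: affine_points_def P_def)
  let ?h = "\<lambda>z. (z\<^sup>2 mod P, 2 * z ^ 3 mod P)"
  have "bij_betw ?h {0..<P} (affine_points g p)"
    unfolding bij_betw_def
  proof
    show "inj_on ?h {0..<P}"
    proof (rule inj_onI)
      fix z w assume zw: "z \<in> {0..<P}" "w \<in> {0..<P}" and "?h z = ?h w"
      then have sq: "P dvd z\<^sup>2 - w\<^sup>2" and "P dvd 2 * z ^ 3 - 2 * w ^ 3"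
        by (auto simp: mod_eq_dvd_iff)
      \<comment> \<open>Replacing w^2 by z^2 in 2w^3 leaves 2z^3 - 2wz^2, which has the factor z -
        w.\<close>
      from this(2,1) have "P dvd (2 * z ^ 3 - 2 * w ^ 3) - 2 * w * (z\<^sup>2 - w\<^sup>2)"
        by (rule dvd_diff[OF _ dvd_mult])
      then have "P dvd 2 * (z\<^sup>2 * (z - w))"
        by (simp add: algebra_simps power2_eq_square power3_eq_cube)
      then have "P dvd z \<or> P dvd z - w"
        using P two by (simp add: prime_dvd_mult_iff prime_dvd_power_iff)
      \<comment> \<open>At the cusp the factor z^2 already vanishes, so z - w must be reached
        through the equality of squares.\<close>
      moreover have "P dvd z - w" if "P dvd z"
      proof -
        have "P dvd z\<^sup>2" using that by (simp add: power2_eq_square)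
        then have "P dvd w\<^sup>2" using dvd_diff[OF _ sq, of "z\<^sup>2"] by simp
        then have "P dvd w" using P prime_dvd_power by blast
        with that show ?thesis by (rule dvd_diff)
      qed
      ultimately show "z = w"
        using zw by (intro cong_residues_eq[of z w P]) (auto simp: cong_iff_dvd_diff)
    qed
    show "?h ` {0..<P} = affine_points g p"
    proof (intro equalityI subsetI)
      fix u assume "u \<in> ?h ` {0..<P}"
      then obtain z where u: "u = ?h z" by blast
      have "[(2 * z ^ 3 mod P)\<^sup>2 = (2 * z ^ 3)\<^sup>2] (mod P)"
        by (simp add: cong_def power_mod)
      also have "(2 * z ^ 3)\<^sup>2 = 4 * (z\<^sup>2) ^ 3"
        by (simp add: power_mult_distrib flip: power_mult)
      also have "[4 * (z\<^sup>2) ^ 3 = 4 * (z\<^sup>2 mod P) ^ 3] (mod P)"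
        by (intro cong_mult cong_pow) (auto simp: cong_def)
      finally show "u \<in> affine_points g p"
        using u P by (simp add: mem)
    next
      fix u assume "u \<in> affine_points g p"
      then obtain x y where u: "u = (x, y)" "x \<in> {0..<P}" "y \<in> {0..<P}"
          and curve: "P dvd y\<^sup>2 - 4 * x ^ 3"
        by (cases u) (auto simp: mem cong_iff_dvd_diff)
      have "\<exists>z\<in>{0..<P}. P dvd z\<^sup>2 - x \<and> P dvd 2 * z ^ 3 - y"
      proof (cases "x = 0")
        case True
        then have "P dvd y" using curve P prime_dvd_power by auto
        then show ?thesis using True P by (intro bexI[of _ 0]) auto
      next
        case False
        then have x: "\<not> P dvd x" using u zdvd_not_zless[of x P] by auto
        then have "\<not> P dvd 2 * x" using two P by (simp add: prime_dvd_mult_iff)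
        \<comment> \<open>z is half the slope y/x of the line joining the point to the cusp.\<close>
        then obtain z where z: "z \<in> {0..<P}" and "[(2 * x) * z = y] (mod P)"
          using linear_cong_solvable[OF P(1)] by blast
        then have lin: "P dvd 2 * x * z - y" by (simp add: cong_iff_dvd_diff)
        \<comment> \<open>The product is (2xz)^2 - y^2; adding the curve equation eliminates y and
          leaves 4x^2(z^2 - x), where 4x^2 is invertible.\<close>
        then have "P dvd (2 * x * z - y) * (2 * x * z + y) + (y\<^sup>2 - 4 * x ^ 3)"
          using curve by (intro dvd_add) auto
        also have "\<dots> = 2\<^sup>2 * (x\<^sup>2 * (z\<^sup>2 - x))"
          by (simp add: algebra_simps power2_eq_square power3_eq_cube)
        finally have sq: "P dvd z\<^sup>2 - x"
          using P two x
          by (simp add: prime_dvd_mult_iff prime_dvd_power_iff del: power_numeral)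
        then have "P dvd 2 * z * (z\<^sup>2 - x) + (2 * x * z - y)"
          using lin by (intro dvd_add) auto
        also have "\<dots> = 2 * z ^ 3 - y"
          by (simp add: algebra_simps power2_eq_square power3_eq_cube)
        finally show ?thesis using z sq by blast
      qed
      then obtain z where z: "z \<in> {0..<P}" "z\<^sup>2 mod P = x mod P" "2 * z ^ 3 mod P = y mod P"
        by (auto simp: mod_eq_dvd_iff)
      then have "u = ?h z" using u by simp
      then show "u \<in> ?h ` {0..<P}" using z(1) by blast
    qed
  qed
  then have "card {0..<P} = card (affine_points g p)"
    by (rule bij_betw_same_card)
  then show ?thesis by (simp add: P_def)
qed

text \<open>In the excluded case, p divides n but not 4m+1, every fibre is the nodal cubic y^2 =
  x^2(4x + 4m + 1). Each trace is then the Legendre symbol of 4m+1, so the first moment is 1 or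
  -1.\<close>

theorem lemma2p4:
  fixes p :: nat and m n :: int
  assumes "prime p" and "odd p"
    and "\<not> int p dvd n \<or> int p dvd 4 * m + 1"
  shows "first_moment (family_E m n) p = 0"
proof -
  have "(\<Sum>t\<in>{0..<int p}. card (affine_points (fibre (family_E m n) t) p)) = p\<^sup>2"
  proof (cases "int p dvd n")
    case False
    with assms(1) show ?thesis by (rule sum_card_affine_points_family_E)
  next
    case True
    with assms(3) have "int p dvd 4 * m + 1" by blast
    then have "[poly (fibre (family_E m n) t) x = 4 * x ^ 3] (mod int p)" for t x
      using True by (simp add: poly_fibre_family_E cong_iff_dvd_diff)
    then show ?thesis
      using assms(1,2) by (simp add: card_affine_points_cuspidal power2_eq_square)
  qed
  then show ?thesis
    using first_moment_eq_0_iff assms(1) prime_gt_0_nat by blast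
qed

end
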